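(* Let $X$ and $Y$ be metrizable spaces (in particular, subsets of $\mathbb{R}$) and assume that $Y$ is $l$-dominated by $X$. If $X$ is a $Q$-set, then $Y$ is also a $Q$-set.
   Context: For a Tychonoff space $X$, $C_p(X)$ is the space of all real-valued continuous functions on $X$ endowed with the topology of pointwise convergence. A space $Y$ is $l$-dominated by a space $X$ if there exists a continuous linear surjection from $C_p(X)$ onto $C_p(Y)$. A metrizable space $X$ is called a $Q$-set if each subset of $X$ is an $F_{\sigma}$-set in $X$ (equivalently, each subset of $X$ is a $G_\delta$-set in $X$). *)

theory Defs
  imports "HOL-Analysis.Analysis"
begin

(* A real function on the space X is represented by its extensional version, i.e. it takes the
   value "undefined" outside topspace X; this makes equality in Cp X equality of functions on X,
   and is the reason for the "restrict" in the pointwise operations below.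
   The definitions make sense for every topology; Tychonoff spaces, hence metrizable ones,
   are a special case. *)

definition Cp :: "'a topology \<Rightarrow> ('a \<Rightarrow> real) topology" where
  "Cp X = subtopology (product_topology (\<lambda>_. euclideanreal) (topspace X))
            {f. continuous_map X euclideanreal f}"

definition Cp_linear :: "'a topology \<Rightarrow> 'b topology \<Rightarrow> (('a \<Rightarrow> real) \<Rightarrow> ('b \<Rightarrow> real)) \<Rightarrow> bool" where
  "Cp_linear X Y T \<longleftrightarrow>
     (\<forall>f\<in>topspace (Cp X). \<forall>g\<in>topspace (Cp X).
        T (\<lambda>x\<in>topspace X. f x + g x) = (\<lambda>y\<in>topspace Y. T f y + T g y)) \<and>
     (\<forall>c. \<forall>f\<in>topspace (Cp X).
        T (\<lambda>x\<in>topspace X. c * f x) = (\<lambda>y\<in>topspace Y. c * T f y))"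

definition l_dominated :: "'b topology \<Rightarrow> 'a topology \<Rightarrow> bool"
    (infix \<open>l'_dominated'_by\<close> 50) where
  "Y l_dominated_by X \<longleftrightarrow>
     (\<exists>T. continuous_map (Cp X) (Cp Y) T \<and> Cp_linear X Y T \<and>
          T ` topspace (Cp X) = topspace (Cp Y))"

definition Q_set :: "'a topology \<Rightarrow> bool" where
  "Q_set X \<longleftrightarrow> metrizable_space X \<and> (\<forall>S. S \<subseteq> topspace X \<longrightarrow> fsigma_in X S)"

lemma topspace_Cp:
  "topspace (Cp X) = {f \<in> extensional (topspace X). continuous_map X euclideanreal f}"
  by (auto simp: Cp_def PiE_def)

lemma Q_set_iff_gdelta:
  "Q_set X \<longleftrightarrow> metrizable_space X \<and> (\<forall>S. S \<subseteq> topspace X \<longrightarrow> gdelta_in X S)"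
proof -
  have "(\<forall>S. S \<subseteq> topspace X \<longrightarrow> fsigma_in X S) \<longleftrightarrow> (\<forall>S. S \<subseteq> topspace X \<longrightarrow> gdelta_in X S)"
    by (metis Diff_subset fsigma_in_gdelta_in gdelta_in_fsigma_in)
  then show ?thesis
    by (simp add: Q_set_def)
qed

end

theory Submission
  imports Defs "HOL-Library.Function_Algebras"
begin

text \<open>
  The argument compares two ways in which all real functions, continuous or not, can be reached
  from the continuous ones. On a \<open>Q\<close>-set every function is the pointwise limit of a sequence of
  continuous functions (\<open>Q_set_imp_pointwise_limit\<close>): all its level sets are \<open>F\<^sub>\<sigma>\<close>, so it has
  Baire class one. Conversely a metrizable space is a \<open>Q\<close>-set as soon as every indicator function
  is such a limit (\<open>pointwise_limit_indicator_imp_fsigma_in\<close>). So it suffices to carry the property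
  "every function has Baire class one" from \<open>X\<close> to \<open>Y\<close> along a continuous linear surjection
  \<open>T\<close> from \<open>C\<^sub>p(X)\<close> onto \<open>C\<^sub>p(Y)\<close>.

  By continuity in the topology of pointwise convergence, each functional \<open>f \<mapsto> T f y\<close> is a finite
  linear combination of evaluations at points of \<open>X\<close> (\<open>pullback_in_span_evaluation\<close>). The same
  combinations extend \<open>T\<close> to a map from all functions on \<open>X\<close> to all functions on \<open>Y\<close> that respects
  pointwise limits, so only the surjectivity of the extension is at stake. This is pure linear
  algebra: since \<open>T\<close> is onto, the functionals \<open>f \<mapsto> T f y\<close> are linearly independent
  (\<open>pullback_independent\<close>), hence for any prescribed \<open>g\<close> on \<open>Y\<close> there is a linear form \<open>h\<close> on the
  space of all functionals with value \<open>g y\<close> at \<open>f \<mapsto> T f y\<close>. The values of \<open>h\<close> at the evaluations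
  make up a function on \<open>X\<close> that the extension of \<open>T\<close> sends to \<open>g\<close>. If continuous \<open>F n\<close> converge
  pointwise to it, then the continuous functions \<open>T (F n)\<close> converge pointwise to \<open>g\<close>.
\<close>

section \<open>Functions on a Q-set are pointwise limits of continuous functions\<close>

text \<open>
  A finite insertion theorem, proved by adding the thresholds in increasing order. For a new largest threshold \<open>q\<close>, cutting the previous function off at \<open>q\<close> settles the upper bound on
  \<open>L q\<close> and breaks no earlier bound; a Urysohn function then lifts it to \<open>q\<close> on \<open>K q\<close> without
  changing it on the earlier sets \<open>L r\<close>.
\<close>
lemma normal_space_interpolation:
  fixes Q :: "real set"
  assumes X: "normal_space X" and "finite Q"
    and "\<And>q. q \<in> Q \<Longrightarrow> closedin X (K q)" and "\<And>q. q \<in> Q \<Longrightarrow> closedin X (L q)"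
    and "\<And>q r. q \<in> Q \<Longrightarrow> r \<in> Q \<Longrightarrow> r \<le> q \<Longrightarrow> disjnt (K q) (L r)"
  shows "\<exists>f. continuous_map X euclideanreal f \<and>
             (\<forall>q\<in>Q. (\<forall>x\<in>K q. q \<le> f x) \<and> (\<forall>x\<in>L q. f x \<le> q))"
  using assms(2-5)
proof (induction Q rule: finite_linorder_max_induct)
  case empty
  show ?case
    by (rule exI[of _ "\<lambda>x. 0"]) auto
next
  case (insert q Q)
  have "\<exists>f. continuous_map X euclideanreal f \<and>
             (\<forall>q\<in>Q. (\<forall>x\<in>K q. q \<le> f x) \<and> (\<forall>x\<in>L q. f x \<le> q))"
    using insert.prems by (intro insert.IH) auto
  then obtain f where f: "continuous_map X euclideanreal f"
      "\<And>r x. r \<in> Q \<Longrightarrow> x \<in> K r \<Longrightarrow> r \<le> f x" "\<And>r x. r \<in> Q \<Longrightarrow> x \<in> L r \<Longrightarrow> f x \<le> r"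
    by blast
  have "closedin X (\<Union>r\<in>Q. L r)"
    using insert.prems insert.hyps by (intro closedin_Union) auto
  moreover have "disjnt (\<Union>r\<in>Q. L r) (K q)"
    using insert.prems(3)[of q] insert.hyps(2) by (fastforce simp: disjnt_def)
  ultimately obtain h where h: "continuous_map X (top_of_set {0..1::real}) h"
      "h ` (\<Union>r\<in>Q. L r) \<subseteq> {0}" "h ` K q \<subseteq> {1}"
    using Urysohn_lemma[OF X, of "\<Union>r\<in>Q. L r" "K q" 0 1] insert.prems(1) by auto
  have hc: "continuous_map X euclideanreal h" and h01: "\<And>x. x \<in> topspace X \<Longrightarrow> 0 \<le> h x \<and> h x \<le> 1"
    using h(1) by (auto simp: continuous_map_in_subtopology)
  define f' where "f' x = min (f x) q + (q - min (f x) q) * h x" for x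
  have "continuous_map X euclideanreal f'"
    unfolding f'_def
    by (intro continuous_map_add continuous_map_real_mult continuous_map_diff
        continuous_map_real_min f(1) hc continuous_map_const[THEN iffD2]) auto
  moreover have between: "min (f x) q \<le> f' x \<and> f' x \<le> q" if "x \<in> topspace X" for x
  proof -
    have "(q - min (f x) q) * h x \<ge> 0"
      using h01[OF that] by (intro mult_nonneg_nonneg) auto
    moreover have "(q - min (f x) q) * h x \<le> (q - min (f x) q) * 1"
      using h01[OF that] by (intro mult_left_mono) auto
    ultimately show ?thesis by (simp add: f'_def)
  qed
  have "r \<le> f' x" if "r \<in> insert q Q" "x \<in> K r" for r x
  proof (cases "r = q")
    case True
    then have "h x = 1" using h(3) that by auto
    then show ?thesis using True by (simp add: f'_def)
  next
    case False
    have "x \<in> topspace X"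
      using insert.prems(1)[of r] that closedin_subset by blast
    moreover have "r \<le> min (f x) q"
      using False that f(2)[of r x] insert.hyps(2) by fastforce
    ultimately show ?thesis using between by fastforce
  qed
  moreover have "f' x \<le> r" if "r \<in> insert q Q" "x \<in> L r" for r x
  proof (cases "r = q")
    case True
    have "x \<in> topspace X"
      using insert.prems(2)[of r] that closedin_subset by blast
    then show ?thesis using between True by blast
  next
    case False
    then have "h x = 0" using h(2) that by auto
    then have "f' x = min (f x) q" by (simp add: f'_def)
    then show ?thesis using f(3)[of r x] that False by auto
  qed
  ultimately show ?case by blast
qed

lemma fsigma_in_imp_closed_exhaustion:
  assumes "fsigma_in X S"
  shows "\<exists>K. (\<forall>n. closedin X (K n) \<and> K n \<subseteq> S) \<and> (\<forall>x\<in>S. \<forall>\<^sub>F n in sequentially. x \<in> K n)"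
proof -
  obtain K where K: "\<And>n. closedin X (K n)" "\<And>n. K n \<subseteq> K (Suc n)" "\<Union>(range K) = S"
    using assms unfolding fsigma_in_ascending by blast
  have "\<forall>\<^sub>F n in sequentially. x \<in> K n" if xS: "x \<in> S" for x
  proof -
    obtain m where "x \<in> K m" using K(3) xS by blast
    then have "x \<in> K n" if "m \<le> n" for n
      using lift_Suc_mono_le[of K, OF K(2) that] by blast
    then show ?thesis by (auto simp: eventually_sequentially)
  qed
  with K show ?thesis by (intro exI[of _ K]) auto
qed

text \<open>
  For each threshold \<open>q\<close> the sets where \<open>q < f\<close> and where \<open>f \<le> q\<close> are both exhausted by closed sets
  \<open>K q n\<close> and \<open>L q n\<close>. The \<open>n\<close>-th approximation lies on the correct side of the first \<open>n\<close> rational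
  thresholds on the \<open>n\<close>-th of these closed sets, so at each point every rational threshold
  eventually separates the approximations in the same way as it separates \<open>f\<close>.
\<close>
lemma Q_set_imp_pointwise_limit:
  fixes f :: "'a \<Rightarrow> real"
  assumes "Q_set X"
  shows "\<exists>F. (\<forall>n. continuous_map X euclideanreal (F n)) \<and>
             (\<forall>x\<in>topspace X. (\<lambda>n. F n x) \<longlonglongrightarrow> f x)"
proof -
  have X: "normal_space X" and fs: "\<And>S. S \<subseteq> topspace X \<Longrightarrow> fsigma_in X S"
    using assms by (auto simp: Q_set_def metrizable_imp_normal_space)
  have "\<forall>q. \<exists>K. (\<forall>n. closedin X (K n) \<and> K n \<subseteq> {x \<in> topspace X. q < f x}) \<and>
          (\<forall>x\<in>{x \<in> topspace X. q < f x}. \<forall>\<^sub>F n in sequentially. x \<in> K n)"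
    by (intro allI fsigma_in_imp_closed_exhaustion fs) auto
  from choice[OF this] obtain K where K: "\<And>q n. closedin X (K q n)"
      "\<And>q n x. x \<in> K q n \<Longrightarrow> q < f x"
      "\<And>q x. x \<in> topspace X \<Longrightarrow> q < f x \<Longrightarrow> \<forall>\<^sub>F n in sequentially. x \<in> K q n"
    by blast
  have "\<forall>q. \<exists>L. (\<forall>n. closedin X (L n) \<and> L n \<subseteq> {x \<in> topspace X. f x \<le> q}) \<and>
          (\<forall>x\<in>{x \<in> topspace X. f x \<le> q}. \<forall>\<^sub>F n in sequentially. x \<in> L n)"
    by (intro allI fsigma_in_imp_closed_exhaustion fs) auto
  from choice[OF this] obtain L where L: "\<And>q n. closedin X (L q n)"
      "\<And>q n x. x \<in> L q n \<Longrightarrow> f x \<le> q"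
      "\<And>q x. x \<in> topspace X \<Longrightarrow> f x \<le> q \<Longrightarrow> \<forall>\<^sub>F n in sequentially. x \<in> L q n"
    by blast
  (* e enumerates the rational numbers *)
  define e :: "nat \<Rightarrow> real" where "e n = of_rat (from_nat_into UNIV n)" for n
  have e_dense: "\<exists>n. a < e n \<and> e n < b" if ab: "a < b" for a b
  proof -
    obtain r where "a < of_rat r" "of_rat r < b" using of_rat_dense[OF ab] by blast
    moreover obtain n where "r = from_nat_into UNIV n"
      using from_nat_into_surj[of "UNIV :: rat set" r] by auto
    ultimately show ?thesis by (intro exI[of _ n]) (simp add: e_def)
  qed
  have "\<forall>n. \<exists>g. continuous_map X euclideanreal g \<and>
          (\<forall>q\<in>e ` {..<n}. (\<forall>x\<in>K q n. q \<le> g x) \<and> (\<forall>x\<in>L q n. g x \<le> q))"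
  proof (rule allI, rule normal_space_interpolation[OF X])
    show "disjnt (K q n) (L r n)" if "r \<le> q" for q r n
      using K(2) L(2) that by (fastforce simp: disjnt_def)
  qed (use K L in auto)
  from choice[OF this] obtain F where F: "\<forall>n. continuous_map X euclideanreal (F n) \<and>
      (\<forall>q\<in>e ` {..<n}. (\<forall>x\<in>K q n. q \<le> F n x) \<and> (\<forall>x\<in>L q n. F n x \<le> q))"
    by (rule exE)
  then have FK: "e i \<le> F n x" if "i < n" "x \<in> K (e i) n" for n i x
    using that by auto
  have FL: "F n x \<le> e i" if "i < n" "x \<in> L (e i) n" for n i x
    using F that by auto
  have "(\<lambda>n. F n x) \<longlonglongrightarrow> f x" if x: "x \<in> topspace X" for x
  proof (rule order_tendstoI)
    fix a assume "a < f x"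
    then obtain i where i: "a < e i" "e i < f x" using e_dense by blast
    from K(3)[OF x i(2)] eventually_gt_at_top[of i]
    show "eventually (\<lambda>n. a < F n x) sequentially"
      by eventually_elim (rule less_le_trans[OF i(1) FK])
  next
    fix a assume "f x < a"
    then obtain i where i: "f x < e i" "e i < a" using e_dense by blast
    from L(3)[OF x less_imp_le[OF i(1)]] eventually_gt_at_top[of i]
    show "eventually (\<lambda>n. F n x < a) sequentially"
      by eventually_elim (rule le_less_trans[OF FL i(2)])
  qed
  moreover have "continuous_map X euclideanreal (F n)" for n
    using F by blast
  ultimately show ?thesis by (intro exI[of _ F] conjI allI ballI)
qed

lemma pointwise_limit_indicator_imp_fsigma_in:
  assumes "S \<subseteq> topspace Y" and G: "\<And>n. continuous_map Y euclideanreal (G n)"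
    and lim: "\<And>y. y \<in> topspace Y \<Longrightarrow> (\<lambda>n. G n y) \<longlonglongrightarrow> indicator S y"
  shows "fsigma_in Y S"
proof -
  define C where "C N = {y \<in> topspace Y. \<forall>n\<ge>N. 1/2 \<le> G n y}" for N :: nat
  have "closedin Y (C N)" for N
  proof -
    have "closedin Y {y \<in> topspace Y. G n y \<in> {1/2..}}" for n
      by (rule closedin_continuous_map_preimage[OF G]) auto
    then have "closedin Y (\<Inter>n\<in>{N..}. {y \<in> topspace Y. G n y \<in> {1/2..}})"
      by (intro closedin_Inter) auto
    moreover have "(\<Inter>n\<in>{N..}. {y \<in> topspace Y. G n y \<in> {1/2..}}) = C N"
      by (auto simp: C_def)
    ultimately show ?thesis by simp
  qed
  moreover have C: "(\<Union>N. C N) = S"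
  proof (intro subset_antisym subsetI)
    fix y assume "y \<in> (\<Union>N. C N)"
    then obtain N where y: "y \<in> topspace Y" and N: "\<And>n. N \<le> n \<Longrightarrow> 1/2 \<le> G n y"
      by (auto simp: C_def)
    have "1/2 \<le> (indicator S y :: real)"
      by (rule LIMSEQ_le_const[OF lim[OF y]]) (use N in blast)
    then show "y \<in> S" by (cases "y \<in> S") auto
  next
    fix y assume "y \<in> S"
    with assms(1) have y: "y \<in> topspace Y" by blast
    have "eventually (\<lambda>n. 1/2 < G n y) sequentially"
      using order_tendstoD(1)[OF lim[OF y], of "1/2"] \<open>y \<in> S\<close> by simp
    then show "y \<in> (\<Union>N. C N)"
      using y by (auto simp: eventually_sequentially C_def) (meson less_imp_le)
  qed
  ultimately have "fsigma_in Y (\<Union>N. C N)"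
    by (intro fsigma_in_Union) (auto intro: closed_imp_fsigma_in)
  with C show ?thesis by simp
qed

section \<open>Real functionals as a vector space\<close>

lemma vector_space_functional:
  "vector_space (\<lambda>(c::real) (\<phi> :: 'c \<Rightarrow> real) z. c * \<phi> z)"
  by (rule vector_space.intro) (simp_all add: plus_fun_def distrib_left distrib_right mult.assoc)

lemma vector_space_real: "vector_space ((*) :: real \<Rightarrow> real \<Rightarrow> real)"
  by (rule vector_space.intro) (simp_all add: distrib_left distrib_right)

interpretation functional: vector_space "\<lambda>(c::real) (\<phi> :: 'c \<Rightarrow> real) z. c * \<phi> z"
  by (rule vector_space_functional)

interpretation functional_real: vector_space_pair
    "\<lambda>(c::real) (\<phi> :: 'c \<Rightarrow> real) z. c * \<phi> z" "(*) :: real \<Rightarrow> real \<Rightarrow> real"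
  by (rule vector_space_pair.intro[OF vector_space_functional vector_space_real])

text \<open>
  Independence is phrased for the family, not for its range, so that it includes injectivity:
  equal members at different indices could not be given different values.
\<close>
lemma linear_extension_of_independent_family:
  fixes \<Phi> :: "'b \<Rightarrow> ('c \<Rightarrow> real)" and g :: "'b \<Rightarrow> real"
  assumes indep: "\<And>y. y \<in> A \<Longrightarrow> \<Phi> y \<notin> functional.span (\<Phi> ` (A - {y}))"
  shows "\<exists>h. Vector_Spaces.linear (\<lambda>c \<phi> z. c * \<phi> z) (*) h \<and> (\<forall>y\<in>A. h (\<Phi> y) = g y)"
proof -
  have inj: "inj_on \<Phi> A"
  proof (rule inj_onI, rule ccontr)
    fix y z assume *: "y \<in> A" "z \<in> A" "\<Phi> y = \<Phi> z" "y \<noteq> z"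
    then have "\<Phi> y \<in> \<Phi> ` (A - {y})" by (intro image_eqI[of _ _ z]) auto
    from functional.span_base[OF this] indep[OF *(1)] show False by contradiction
  qed
  have "functional.independent (\<Phi> ` A)"
    unfolding functional.dependent_def
  proof clarify
    fix y assume y: "y \<in> A" "\<Phi> y \<in> functional.span (\<Phi> ` A - {\<Phi> y})"
    have "\<Phi> ` A - {\<Phi> y} \<subseteq> \<Phi> ` (A - {y})" by auto
    from functional.span_mono[OF this] y(2) have "\<Phi> y \<in> functional.span (\<Phi> ` (A - {y}))" by (rule subsetD)
    with indep[OF y(1)] show False by contradiction
  qed
  from functional_real.linear_independent_extend[OF this, of "g \<circ> inv_into A \<Phi>"]
  obtain h where h: "Vector_Spaces.linear (\<lambda>c \<phi> z. c * \<phi> z) (*) h \<and>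
      (\<forall>v\<in>\<Phi> ` A. h v = (g \<circ> inv_into A \<Phi>) v)"
    by (rule exE)
  show ?thesis
    by (rule exI[of _ h], rule conjI[OF conjunct1[OF h]]) (simp add: bspec[OF conjunct2[OF h]] inj)
qed

section \<open>Continuous linear maps between function spaces\<close>

lemma restrict_in_Cp:
  assumes "continuous_map X euclideanreal f"
  shows "restrict f (topspace X) \<in> topspace (Cp X)"
proof -
  have "continuous_map X euclideanreal (restrict f (topspace X))"
    by (rule continuous_map_eq[OF assms]) simp
  then show ?thesis unfolding topspace_Cp by simp
qed

lemma continuous_function_isolating_point:
  assumes X: "metrizable_space X" and "finite F" "F \<subseteq> topspace X" "x \<in> topspace X" "x \<notin> F"
  obtains e where "e \<in> topspace (Cp X)" "e x = (1::real)" "\<And>z. z \<in> F \<Longrightarrow> e z = 0"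
proof -
  have "t1_space X"
    using metrizable_imp_Hausdorff_space[OF X] by (rule Hausdorff_imp_t1_space)
  then have "closedin X F" "closedin X {x}"
    using assms(2-4) unfolding t1_space_closedin_finite by simp_all
  then obtain h where h: "continuous_map X (top_of_set {0..1::real}) h" "h ` F \<subseteq> {0}" "h ` {x} \<subseteq> {1}"
    using Urysohn_lemma[OF metrizable_imp_normal_space[OF X], of F "{x}" 0 1] assms(5)
    by (auto simp: disjnt_def)
  then have "continuous_map X euclideanreal h" by (simp add: continuous_map_in_subtopology)
  then have "restrict h (topspace X) \<in> topspace (Cp X)" by (rule restrict_in_Cp)
  moreover have "restrict h (topspace X) x = 1" using h(3) assms(4) by simp
  moreover have "restrict h (topspace X) z = 0" if "z \<in> F" for z
    using h(2) that assms(3) by (auto simp: subset_eq)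
  ultimately show ?thesis by (rule that)
qed

lemma affine_in_Cp:
  assumes "f \<in> topspace (Cp X)" "g \<in> topspace (Cp X)"
  shows "(\<lambda>x\<in>topspace X. a * f x + g x) \<in> topspace (Cp X)"
proof (rule restrict_in_Cp)
  have "continuous_map X euclideanreal f" "continuous_map X euclideanreal g"
    using assms by (simp_all add: topspace_Cp)
  then show "continuous_map X euclideanreal (\<lambda>x. a * f x + g x)"
    by (intro continuous_map_add continuous_map_real_mult_left)
qed

lemma scale_in_Cp:
  assumes "f \<in> topspace (Cp X)"
  shows "(\<lambda>x\<in>topspace X. c * f x) \<in> topspace (Cp X)"
proof (rule restrict_in_Cp)
  show "continuous_map X euclideanreal (\<lambda>x. c * f x)"
    using assms by (intro continuous_map_real_mult_left) (simp add: topspace_Cp)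
qed

lemma Cp_linear_affine:
  assumes T: "Cp_linear X Y T" and f: "f \<in> topspace (Cp X)" and g: "g \<in> topspace (Cp X)"
    and y: "y \<in> topspace Y"
  shows "T (\<lambda>x\<in>topspace X. a * f x + g x) y = a * T f y + T g y"
proof -
  define af where "af = (\<lambda>x\<in>topspace X. a * f x)"
  have "af \<in> topspace (Cp X)"
    unfolding af_def by (rule scale_in_Cp[OF f])
  then have "T (\<lambda>x\<in>topspace X. af x + g x) y = T af y + T g y"
    using T g y by (simp add: Cp_linear_def)
  moreover have "T af y = a * T f y"
    using T f y by (simp add: Cp_linear_def af_def)
  moreover have "(\<lambda>x\<in>topspace X. af x + g x) = (\<lambda>x\<in>topspace X. a * f x + g x)"
    by (auto simp: af_def fun_eq_iff)
  ultimately show ?thesis by simp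
qed

text \<open>
  A basic neighbourhood of zero on which \<open>\<bar>\<phi>\<bar> < 1\<close> restricts only finitely many coordinates. A
  function that vanishes at these stays in the neighbourhood after scaling by any constant, so all
  multiples of its value under \<open>\<phi>\<close> are smaller than one.
\<close>
lemma continuous_functional_finitely_supported:
  fixes \<phi> :: "('a \<Rightarrow> real) \<Rightarrow> real"
  assumes cont: "continuous_map (Cp X) euclideanreal \<phi>"
    and hom: "\<And>c f. f \<in> topspace (Cp X) \<Longrightarrow> \<phi> (\<lambda>x\<in>topspace X. c * f x) = c * \<phi> f"
  shows "\<exists>F. finite F \<and> F \<subseteq> topspace X \<and>
             (\<forall>f\<in>topspace (Cp X). (\<forall>x\<in>F. f x = 0) \<longrightarrow> \<phi> f = 0)"
proof -
  define z :: "'a \<Rightarrow> real" where "z = (\<lambda>x\<in>topspace X. 0)"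
  have z: "z \<in> topspace (Cp X)"
    unfolding z_def by (intro restrict_in_Cp) auto
  have "z = (\<lambda>x\<in>topspace X. 0 * z x)" by (auto simp: z_def)
  then have "\<phi> z = 0" using hom[OF z, of 0] by simp
  define P where "P = {f \<in> topspace (Cp X). \<phi> f \<in> {-1<..<1}}"
  have "openin (Cp X) P"
    unfolding P_def by (rule openin_continuous_map_preimage[OF cont]) simp
  then obtain W where W: "openin (product_topology (\<lambda>_. euclideanreal) (topspace X)) W"
      "P = W \<inter> {f. continuous_map X euclideanreal f}"
    by (auto simp: Cp_def openin_subtopology)
  have "z \<in> P" using z \<open>\<phi> z = 0\<close> by (simp add: P_def)
  then have "z \<in> W" using W(2) by blast
  with W(1) obtain U where U: "finite {x \<in> topspace X. U x \<noteq> UNIV}"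
      "z \<in> PiE (topspace X) U" "PiE (topspace X) U \<subseteq> W"
    unfolding openin_product_topology_alt by auto
  show ?thesis
  proof (intro exI conjI ballI impI, rule U(1))
    fix f assume f: "f \<in> topspace (Cp X)" and f0: "\<forall>x\<in>{x \<in> topspace X. U x \<noteq> UNIV}. f x = 0"
    have small: "\<bar>c * \<phi> f\<bar> < 1" for c
    proof -
      define cf where "cf = (\<lambda>x\<in>topspace X. c * f x)"
      have cf: "cf \<in> topspace (Cp X)"
        unfolding cf_def by (rule scale_in_Cp[OF f])
      have "cf x \<in> U x" if "x \<in> topspace X" for x
      proof (cases "U x = UNIV")
        case False
        then have "cf x = z x" using f0 that by (simp add: cf_def z_def)
        then show ?thesis using U(2) that by (auto simp: PiE_iff)
      qed simp
      then have "cf \<in> PiE (topspace X) U" by (auto simp: cf_def)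
      then have "cf \<in> W" using U(3) by blast
      moreover have "continuous_map X euclideanreal cf" using cf by (simp add: topspace_Cp)
      ultimately have "cf \<in> P" using W(2) by blast
      then have "\<bar>\<phi> cf\<bar> < 1" by (auto simp: P_def)
      then show ?thesis using hom[OF f] by (simp add: cf_def)
    qed
    show "\<phi> f = 0"
      (* the multiple of f on which \<phi> would take the value one *)
      using small[of "1 / \<phi> f"] by (cases "\<phi> f = 0") auto
  qed auto
qed

text \<open>
  Functionals on \<open>C\<^sub>p(X)\<close> are continued by zero to all functions. Two of them are then equal as
  HOL functions exactly when they agree on \<open>C\<^sub>p(X)\<close>, and the vector space of all functionals can
  serve as the ambient space.
\<close>
definition evaluation :: "'a topology \<Rightarrow> 'a \<Rightarrow> ('a \<Rightarrow> real) \<Rightarrow> real" where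
  "evaluation X x f = (if f \<in> topspace (Cp X) then f x else 0)"

definition pullback :: "'a topology \<Rightarrow> (('a \<Rightarrow> real) \<Rightarrow> ('b \<Rightarrow> real)) \<Rightarrow> 'b \<Rightarrow> ('a \<Rightarrow> real) \<Rightarrow> real" where
  "pullback X T y f = (if f \<in> topspace (Cp X) then T f y else 0)"

text \<open>
  The support is emptied point by point. If \<open>e\<close> is one at \<open>x\<close> and zero on the rest \<open>F\<close> of the
  support, then subtracting \<open>\<phi> e\<close> times the evaluation at \<open>x\<close> leaves a functional supported by
  \<open>F\<close>.
\<close>
lemma finitely_supported_functional_in_span:
  assumes X: "metrizable_space X" and "finite F" "F \<subseteq> topspace X"
    and "\<And>f. f \<notin> topspace (Cp X) \<Longrightarrow> \<phi> f = 0"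
    and "\<And>a f g. f \<in> topspace (Cp X) \<Longrightarrow> g \<in> topspace (Cp X) \<Longrightarrow>
           \<phi> (\<lambda>x\<in>topspace X. a * f x + g x) = a * \<phi> f + \<phi> g"
    and "\<And>f. f \<in> topspace (Cp X) \<Longrightarrow> (\<And>x. x \<in> F \<Longrightarrow> f x = 0) \<Longrightarrow> \<phi> f = 0"
  shows "\<phi> \<in> functional.span (evaluation X ` topspace X)"
  using assms(2-)
proof (induction F arbitrary: \<phi> rule: finite_induct)
  case empty
  have "\<phi> f = 0" for f
    using empty.prems(2,4)[of f] by blast
  then have "\<phi> = 0" by auto
  show ?case unfolding \<open>\<phi> = 0\<close> by (rule functional.span_zero)
next
  case (insert x F)
  obtain e where e: "e \<in> topspace (Cp X)" "e x = 1" "\<And>z. z \<in> F \<Longrightarrow> e z = 0"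
    using continuous_function_isolating_point[OF X, of F x] insert.hyps insert.prems(1) by auto
  have x: "x \<in> topspace X" using insert.prems(1) by simp
  define \<psi> where "\<psi> f = \<phi> f - \<phi> e * evaluation X x f" for f
  have "\<psi> \<in> functional.span (evaluation X ` topspace X)"
  proof (rule insert.IH)
    show "F \<subseteq> topspace X" using insert.prems(1) by simp
    show "\<psi> f = 0" if "f \<notin> topspace (Cp X)" for f
      using that insert.prems(2) by (simp add: \<psi>_def evaluation_def)
    show "\<psi> (\<lambda>x\<in>topspace X. a * f x + g x) = a * \<psi> f + \<psi> g"
      if "f \<in> topspace (Cp X)" "g \<in> topspace (Cp X)" for a f g
    proof -
      have "evaluation X x (\<lambda>x\<in>topspace X. a * f x + g x) = a * evaluation X x f + evaluation X x g"
        using affine_in_Cp[OF that] that x by (simp add: evaluation_def)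
      then show ?thesis
        unfolding \<psi>_def insert.prems(3)[OF that] by (simp add: right_diff_distrib distrib_left)
    qed
    show "\<psi> f = 0" if f: "f \<in> topspace (Cp X)" "\<And>z. z \<in> F \<Longrightarrow> f z = 0" for f
    proof -
      have "(\<lambda>z\<in>topspace X. - f x * e z + f z) \<in> topspace (Cp X)"
        by (rule affine_in_Cp[OF e(1) f(1)])
      then have "\<phi> (\<lambda>z\<in>topspace X. - f x * e z + f z) = 0"
      proof (rule insert.prems(4))
        show "(\<lambda>z\<in>topspace X. - f x * e z + f z) z = 0" if "z \<in> insert x F" for z
          using that e(2,3) f(2) insert.prems(1) by auto
      qed
      then have "- f x * \<phi> e + \<phi> f = 0"
        unfolding insert.prems(3)[OF e(1) f(1)] .
      then show ?thesis
        using f(1) by (simp add: \<psi>_def evaluation_def mult.commute)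
    qed
  qed
  moreover have "(\<lambda>f. \<phi> e * evaluation X x f) \<in> functional.span (evaluation X ` topspace X)"
    using x by (intro functional.span_scale functional.span_base) auto
  ultimately have "\<psi> + (\<lambda>f. \<phi> e * evaluation X x f) \<in> functional.span (evaluation X ` topspace X)"
    by (rule functional.span_add)
  moreover have "\<psi> + (\<lambda>f. \<phi> e * evaluation X x f) = \<phi>"
    by (auto simp: \<psi>_def)
  ultimately show ?case by simp
qed

lemma pullback_in_span_evaluation:
  assumes X: "metrizable_space X" and cont: "continuous_map (Cp X) (Cp Y) T"
    and lin: "Cp_linear X Y T" and y: "y \<in> topspace Y"
  shows "pullback X T y \<in> functional.span (evaluation X ` topspace X)"
proof -
  have "continuous_map (Cp X) euclideanreal (\<lambda>f. T f y)"
    using cont y unfolding Cp_def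
    by (auto simp: continuous_map_in_subtopology continuous_map_componentwise)
  moreover have "T (\<lambda>x\<in>topspace X. c * f x) y = c * T f y" if "f \<in> topspace (Cp X)" for c f
    using lin that y by (simp add: Cp_linear_def)
  ultimately have "\<exists>F. finite F \<and> F \<subseteq> topspace X \<and>
      (\<forall>f\<in>topspace (Cp X). (\<forall>x\<in>F. f x = 0) \<longrightarrow> T f y = 0)"
    by (rule continuous_functional_finitely_supported)
  then obtain F where F: "finite F \<and> F \<subseteq> topspace X \<and>
      (\<forall>f\<in>topspace (Cp X). (\<forall>x\<in>F. f x = 0) \<longrightarrow> T f y = 0)"
    by (rule exE)
  show ?thesis
  proof (rule finitely_supported_functional_in_span[OF X])
    show "finite F" "F \<subseteq> topspace X" using F by simp_all
    show "pullback X T y f = 0" if "f \<notin> topspace (Cp X)" for f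
      using that by (simp add: pullback_def)
    show "pullback X T y (\<lambda>x\<in>topspace X. a * f x + g x) = a * pullback X T y f + pullback X T y g"
      if "f \<in> topspace (Cp X)" "g \<in> topspace (Cp X)" for a f g
      using Cp_linear_affine[OF lin that y] affine_in_Cp[OF that] that by (simp add: pullback_def)
    show "pullback X T y f = 0" if "f \<in> topspace (Cp X)" "\<And>x. x \<in> F \<Longrightarrow> f x = 0" for f
      using F that by (simp add: pullback_def)
  qed
qed

lemma span_determined_by_finite_subfamily:
  assumes "\<psi> \<in> functional.span (\<Phi> ` B)"
  shows "\<exists>A. finite A \<and> A \<subseteq> B \<and> (\<forall>f. (\<forall>y\<in>A. \<Phi> y f = 0) \<longrightarrow> \<psi> f = 0)"
  using assms
proof (induction rule: functional.span_induct_alt)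
  case base
  show ?case by (rule exI[of _ "{}"]) auto
next
  case (step c \<phi> \<psi>)
  then obtain y A where "y \<in> B" "\<phi> = \<Phi> y" "finite A" "A \<subseteq> B" "\<forall>f. (\<forall>y\<in>A. \<Phi> y f = 0) \<longrightarrow> \<psi> f = 0"
    by blast
  then show ?case by (intro exI[of _ "insert y A"]) auto
qed

text \<open>
  A dependence would make \<open>T f y\<close> vanish whenever \<open>T f\<close> vanishes on a certain finite set without
  \<open>y\<close>. As \<open>T\<close> is onto, \<open>T f\<close> can be any continuous function, and one of them isolates \<open>y\<close> from
  that set.
\<close>
lemma pullback_independent:
  assumes Y: "metrizable_space Y" and surj: "T ` topspace (Cp X) = topspace (Cp Y)"
    and y: "y \<in> topspace Y"
  shows "pullback X T y \<notin> functional.span (pullback X T ` (topspace Y - {y}))"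
proof
  assume "pullback X T y \<in> functional.span (pullback X T ` (topspace Y - {y}))"
  from span_determined_by_finite_subfamily[OF this]
  obtain A where A: "finite A" "A \<subseteq> topspace Y - {y}"
      "\<And>f. (\<forall>z\<in>A. pullback X T z f = 0) \<Longrightarrow> pullback X T y f = 0"
    by blast
  then obtain e where e: "e \<in> topspace (Cp Y)" "e y = 1" "\<And>z. z \<in> A \<Longrightarrow> e z = 0"
    using continuous_function_isolating_point[OF Y, of A y] y by blast
  then obtain f where "f \<in> topspace (Cp X)" "T f = e" using surj by (metis imageE)
  with A(3)[of f] e show False by (simp add: pullback_def)
qed

text \<open>
  A sequence of continuous functions that converges pointwise to \<open>x \<mapsto> h (evaluation X x)\<close> does what
  is wanted on evaluations, and linear combinations of evaluations inherit it. For \<open>X\<close> a \<open>Q\<close>-set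
  such a sequence exists, however irregular \<open>h\<close> is.
\<close>
lemma linear_functional_limit_on_span_evaluation:
  assumes X: "Q_set X" and h: "Vector_Spaces.linear (\<lambda>c \<phi> z. c * \<phi> z) (*) h"
  shows "\<exists>F. (\<forall>n. F n \<in> topspace (Cp X)) \<and>
    (\<forall>\<psi>\<in>functional.span (evaluation X ` topspace X). (\<lambda>n. \<psi> (F n)) \<longlonglongrightarrow> h \<psi>)"
proof -
  interpret h: Vector_Spaces.linear "\<lambda>c \<phi> z. c * \<phi> z" "(*)" h by (rule h)
  from Q_set_imp_pointwise_limit[OF X, of "\<lambda>x. h (evaluation X x)"]
  obtain G where G: "(\<forall>n. continuous_map X euclideanreal (G n)) \<and>
      (\<forall>x\<in>topspace X. (\<lambda>n. G n x) \<longlonglongrightarrow> h (evaluation X x))"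
    by (rule exE)
  define F where "F n = restrict (G n) (topspace X)" for n
  have FC: "F n \<in> topspace (Cp X)" for n
    unfolding F_def using G by (intro restrict_in_Cp) simp
  have "(\<lambda>n. \<psi> (F n)) \<longlonglongrightarrow> h \<psi>" if "\<psi> \<in> functional.span (evaluation X ` topspace X)" for \<psi>
    using that
  proof (induction rule: functional.span_induct_alt)
    case base
    show ?case unfolding h.zero by simp
  next
    case (step c \<phi> \<psi>)
    then obtain x where x: "x \<in> topspace X" "\<phi> = evaluation X x" by blast
    have "(\<lambda>n. \<phi> (F n)) \<longlonglongrightarrow> h \<phi>"
      using G FC x by (simp add: evaluation_def F_def)
    then have lim: "(\<lambda>n. c * \<phi> (F n) + \<psi> (F n)) \<longlonglongrightarrow> c * h \<phi> + h \<psi>"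
      using step(2) by (intro tendsto_intros)
    have h_sum: "h ((\<lambda>f. c * \<phi> f) + \<psi>) = c * h \<phi> + h \<psi>"
      by (simp only: h.add h.scale)
    show ?case unfolding h_sum using lim by simp
  qed
  with FC show ?thesis by (intro exI[of _ F] conjI allI ballI)
qed

theorem corollary3p5:
  fixes X :: "'a topology" and Y :: "'b topology"
  assumes "metrizable_space X" and "metrizable_space Y"
    and "Y l_dominated_by X"
    and "Q_set X"
  shows "Q_set Y"
proof -
  obtain T where T: "continuous_map (Cp X) (Cp Y) T" "Cp_linear X Y T"
      "T ` topspace (Cp X) = topspace (Cp Y)"
    using assms(3) unfolding l_dominated_def by blast
  have "fsigma_in Y S" if S: "S \<subseteq> topspace Y" for S
  proof -
    from linear_extension_of_independent_family[OF pullback_independent[OF assms(2) T(3)], of "indicator S"]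
    obtain h where h: "Vector_Spaces.linear (\<lambda>c \<phi> z. c * \<phi> z) (*) h \<and>
        (\<forall>y\<in>topspace Y. h (pullback X T y) = indicator S y)"
      by (rule exE)
    from linear_functional_limit_on_span_evaluation[OF assms(4) conjunct1[OF h]]
    obtain F where F: "(\<forall>n. F n \<in> topspace (Cp X)) \<and>
        (\<forall>\<psi>\<in>functional.span (evaluation X ` topspace X). (\<lambda>n. \<psi> (F n)) \<longlonglongrightarrow> h \<psi>)"
      by (rule exE)
    show ?thesis
    proof (rule pointwise_limit_indicator_imp_fsigma_in[OF S])
      have "T (F n) \<in> topspace (Cp Y)" for n
        using F T(3) by blast
      then show "continuous_map Y euclideanreal (T (F n))" for n
        by (simp add: topspace_Cp)
      show "(\<lambda>n. T (F n) y) \<longlonglongrightarrow> indicator S y" if y: "y \<in> topspace Y" for y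
      proof -
        have "(\<lambda>n. pullback X T y (F n)) \<longlonglongrightarrow> h (pullback X T y)"
          using F pullback_in_span_evaluation[OF assms(1) T(1,2) y] by blast
        then show ?thesis using h y F by (simp add: pullback_def)
      qed
    qed
  qed
  with assms(2) show ?thesis by (simp add: Q_set_def)
qed

end
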